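(* Let $M$ be a connected orientable $2$-manifold with a globally defined null coordinate system $(u,v)$. Let $(s_1,-t_2)^T,\ (t_1,s_2)^T: M\to\mathbb{E}^2_1(u,v)$ be solutions to the Dirac equations with potential $p\in C^\infty(M)$: $$\begin{pmatrix}0&\partial_u\\ -\partial_v&0\end{pmatrix}\begin{pmatrix}s_1\\ -t_2\end{pmatrix}=p\begin{pmatrix}s_1\\ -t_2\end{pmatrix},\qquad \begin{pmatrix}0&\partial_u\\ -\partial_v&0\end{pmatrix}\begin{pmatrix}t_1\\ s_2\end{pmatrix}=p\begin{pmatrix}t_1\\ s_2\end{pmatrix}.$$ Then $$\hat\Phi:=\begin{pmatrix}s_1&-t_2\\ t_1&s_2\end{pmatrix}: M\to\mathbb{H}'_*$$ is a conformal frame of the conformally immersed timelike surface $\varphi=(\varphi_1,\varphi_2,\varphi_3):M\to\mathbb{E}^3_1$, where $$\begin{aligned}\varphi_1&=\frac12\int (s_1^2+t_1^2)\,du-(s_2^2+t_2^2)\,dv,\\ \varphi_2&=\frac12\int (s_1^2-t_1^2)\,du+(s_2^2-t_2^2)\,dv,\\ \varphi_3&=\int(-s_1t_1\,du-s_2t_2\,dv).\end{aligned}$$ The metric $ds^2_\varphi$ and the mean curvature $H$ of $\varphi$ are given by $$ds_\varphi^2=(s_1s_2+t_1t_2)^2\,du\,dv,\qquad H=2p\,e^{-\omega/2},$$ where $\omega$ is the function with $ds^2_\varphi=e^\omega\,du\,dv$.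
   Context: $\mathbb{E}^3_1$ is Minkowski $3$-space: $\mathbb{R}^3$ with coordinates $(x_1,x_2,x_3)$ and metric $\langle\ ,\ \rangle=-dx_1^2+dx_2^2+dx_3^2$. It is identified with the imaginary split-quaternions via $$(x_1,x_2,x_3)\leftrightarrow x_1\mathbf{i}+x_2\mathbf{j}'+x_3\mathbf{k}'=\begin{pmatrix}x_3&x_1+x_2\\ -x_1+x_2&-x_3\end{pmatrix},\quad \mathbf{i}=\begin{pmatrix}0&1\\ -1&0\end{pmatrix},\ \mathbf{j}'=\begin{pmatrix}0&1\\ 1&0\end{pmatrix},\ \mathbf{k}'=\begin{pmatrix}1&0\\ 0&-1\end{pmatrix}.$$ $\mathbb{H}'$ is the algebra of split-quaternions, identified with the real $2\times2$ matrices, and $\mathbb{H}'_*$ is its set of invertible elements. $\mathbb{E}^2_1(u,v)$ is the Minkowski plane with null coordinates $(u,v)$; the components $s_1,s_2,t_1,t_2$ are real-valued functions. An immersion $\varphi:M\to\mathbb{E}^3_1$ is timelike if its induced metric is Lorentzian. It is conformal with respect to the null coordinates $(u,v)$ if $\langle\varphi_u,\varphi_u\rangle=\langle\varphi_v,\varphi_v\rangle=0$ and $\langle\varphi_u,\varphi_v\rangle=\frac12e^{\omega}$; its metric is then written $e^{\omega}\,du\,dv$. With $N$ a unit normal field, $\langle N,N\rangle=1$, the mean curvature is $H=2e^{-\omega}\langle\varphi_{uv},N\rangle$. A coordinate frame of $\varphi$ is a map $\Phi$ into $\mathrm{SL}(2,\mathbb{R})$ with $\Phi\mathbf{i}\Phi^{-1}=e^{-\omega/2}(\varphi_u-\varphi_v)$,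 $\Phi\mathbf{j}'\Phi^{-1}=e^{-\omega/2}(\varphi_u+\varphi_v)$, $\Phi\mathbf{k}'\Phi^{-1}=N$. The corresponding conformal frame is $\hat\Phi=e^{\omega/4}\Phi$, so that $\det\hat\Phi=e^{\omega/2}$ and $$\varphi_u=e^{\omega/2}\hat\Phi\begin{pmatrix}0&1\\ 0&0\end{pmatrix}\hat\Phi^{-1},\qquad \varphi_v=e^{\omega/2}\hat\Phi\begin{pmatrix}0&0\\ 1&0\end{pmatrix}\hat\Phi^{-1}.$$
   Formalization: Invertibility of Φ̂ is assumed (the zero solution violates it); Φ̂ is claimed to be a conformal frame only if det Φ̂ > 0 (a conformal frame has det = e^{ω/2} > 0); φ is shown to exist for simply connected M, and otherwise any single-valued φ given by the integrals is treated. *)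

theory Defs
  imports "HOL-Analysis.Analysis"
begin

text \<open>
  A surface with a global coordinate system \<open>(u, v)\<close> is identified with its coordinate domain,
  a connected open subset of \<open>real \<times> real\<close>. Minkowski 3-space is \<open>real ^ 3\<close>.
\<close>

definition pd_u :: "(real \<times> real \<Rightarrow> 'a::real_normed_vector) \<Rightarrow> real \<times> real \<Rightarrow> 'a" where
  "pd_u f q = vector_derivative (\<lambda>x. f (x, snd q)) (at (fst q))"

definition pd_v :: "(real \<times> real \<Rightarrow> 'a::real_normed_vector) \<Rightarrow> real \<times> real \<Rightarrow> 'a" where
  "pd_v f q = vector_derivative (\<lambda>y. f (fst q, y)) (at (snd q))"

text \<open>
  Class \<open>C\<^sup>k\<close> on an open set. Differentiability is required at each step because
  \<^const>\<open>vector_derivative\<close> has an arbitrary value where the derivative does not exist.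
\<close>

fun C_class :: "nat \<Rightarrow> (real \<times> real) set \<Rightarrow> (real \<times> real \<Rightarrow> 'a::real_normed_vector) \<Rightarrow> bool" where
  "C_class 0 M f = continuous_on M f"
| "C_class (Suc k) M f =
     ((\<forall>q\<in>M. f differentiable (at q)) \<and> C_class k M (pd_u f) \<and> C_class k M (pd_v f))"

definition smooth :: "(real \<times> real) set \<Rightarrow> (real \<times> real \<Rightarrow> 'a::real_normed_vector) \<Rightarrow> bool" where
  "smooth M f \<longleftrightarrow> (\<forall>k. C_class k M f)"

text \<open>
  \<open>f = \<integral> a du + b dv\<close> on \<open>M\<close>: the function \<open>f\<close> is determined up to a constant of integration by
  its increments, which are the line integrals along the piecewise \<open>C\<^sup>1\<close> paths in \<open>M\<close>.
\<close>

definition is_line_integral ::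
  "(real \<times> real) set \<Rightarrow> (real \<times> real \<Rightarrow> real) \<Rightarrow> (real \<times> real \<Rightarrow> real) \<Rightarrow> (real \<times> real \<Rightarrow> real) \<Rightarrow> bool"
where
  "is_line_integral M a b f \<longleftrightarrow>
     (\<forall>\<gamma>. valid_path \<gamma> \<and> path_image \<gamma> \<subseteq> M \<longrightarrow>
        ((\<lambda>t. a (\<gamma> t) * fst (vector_derivative \<gamma> (at t)) + b (\<gamma> t) * snd (vector_derivative \<gamma> (at t)))
           has_integral (f (pathfinish \<gamma>) - f (pathstart \<gamma>))) {0..1})"

definition mink :: "real ^ 3 \<Rightarrow> real ^ 3 \<Rightarrow> real" where
  "mink x y = - (x $ 1) * (y $ 1) + x $ 2 * y $ 2 + x $ 3 * y $ 3"

definition mat2 :: "real \<Rightarrow> real \<Rightarrow> real \<Rightarrow> real \<Rightarrow> real ^ 2 ^ 2" where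
  "mat2 a b c d = vector [vector [a, b], vector [c, d]]"

definition quat_i :: "real ^ 2 ^ 2" where "quat_i = mat2 0 1 (-1) 0"
definition quat_j :: "real ^ 2 ^ 2" where "quat_j = mat2 0 1 1 0"
definition quat_k :: "real ^ 2 ^ 2" where "quat_k = mat2 1 0 0 (-1)"

definition quat :: "real ^ 3 \<Rightarrow> real ^ 2 ^ 2" where
  "quat x = x $ 1 *\<^sub>R quat_i + x $ 2 *\<^sub>R quat_j + x $ 3 *\<^sub>R quat_k"

lemma quat_eq_mat2: "quat x = mat2 (x $ 3) (x $ 1 + x $ 2) (- x $ 1 + x $ 2) (- x $ 3)"
  by (simp add: quat_def quat_i_def quat_j_def quat_k_def mat2_def vec_eq_iff forall_2)

definition induced_metric ::
  "(real \<times> real \<Rightarrow> real ^ 3) \<Rightarrow> real \<times> real \<Rightarrow> real \<times> real \<Rightarrow> real \<times> real \<Rightarrow> real" where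
  "induced_metric \<phi> q X Y = mink (frechet_derivative \<phi> (at q) X) (frechet_derivative \<phi> (at q) Y)"

text \<open>Signature \<open>(1, 1)\<close>: such \<open>X\<close> and \<open>Y\<close> automatically form a basis of the plane.\<close>

definition lorentzian :: "(real \<times> real \<Rightarrow> real \<times> real \<Rightarrow> real) \<Rightarrow> bool" where
  "lorentzian g \<longleftrightarrow> bilinear g \<and> (\<forall>X Y. g X Y = g Y X) \<and>
     (\<exists>X Y. g X X = -1 \<and> g Y Y = 1 \<and> g X Y = 0)"

definition timelike_immersion :: "(real \<times> real) set \<Rightarrow> (real \<times> real \<Rightarrow> real ^ 3) \<Rightarrow> bool" where
  "timelike_immersion M \<phi> \<longleftrightarrow> smooth M \<phi> \<and>
     (\<forall>q\<in>M. inj (frechet_derivative \<phi> (at q)) \<and> lorentzian (induced_metric \<phi> q))"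

definition null_conformal ::
  "(real \<times> real) set \<Rightarrow> (real \<times> real \<Rightarrow> real ^ 3) \<Rightarrow> (real \<times> real \<Rightarrow> real) \<Rightarrow> bool" where
  "null_conformal M \<phi> \<omega> \<longleftrightarrow> smooth M \<omega> \<and>
     (\<forall>q\<in>M. mink (pd_u \<phi> q) (pd_u \<phi> q) = 0 \<and> mink (pd_v \<phi> q) (pd_v \<phi> q) = 0 \<and>
        mink (pd_u \<phi> q) (pd_v \<phi> q) = exp (\<omega> q) / 2)"

text \<open>The quadratic form \<open>du dv\<close>; hence \<open>ds\<^sup>2 = e\<^sup>\<omega> du dv\<close> corresponds to
  \<open>\<langle>\<phi>\<^sub>u, \<phi>\<^sub>v\<rangle> = e\<^sup>\<omega> / 2\<close>.\<close>

definition du_dv :: "real \<times> real \<Rightarrow> real" where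
  "du_dv X = fst X * snd X"

definition has_metric ::
  "(real \<times> real) set \<Rightarrow> (real \<times> real \<Rightarrow> real ^ 3) \<Rightarrow> (real \<times> real \<Rightarrow> real) \<Rightarrow> bool" where
  "has_metric M \<phi> \<rho> \<longleftrightarrow> (\<forall>q\<in>M. \<forall>X. induced_metric \<phi> q X X = \<rho> q * du_dv X)"

definition unit_normal ::
  "(real \<times> real) set \<Rightarrow> (real \<times> real \<Rightarrow> real ^ 3) \<Rightarrow> (real \<times> real \<Rightarrow> real ^ 3) \<Rightarrow> bool" where
  "unit_normal M \<phi> N \<longleftrightarrow> smooth M N \<and>
     (\<forall>q\<in>M. mink (N q) (N q) = 1 \<and> mink (N q) (pd_u \<phi> q) = 0 \<and> mink (N q) (pd_v \<phi> q) = 0)"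

definition mean_curvature ::
  "(real \<times> real \<Rightarrow> real ^ 3) \<Rightarrow> (real \<times> real \<Rightarrow> real) \<Rightarrow> (real \<times> real \<Rightarrow> real ^ 3) \<Rightarrow> real \<times> real \<Rightarrow> real"
where
  "mean_curvature \<phi> \<omega> N q = 2 * exp (- \<omega> q) * mink (pd_v (pd_u \<phi>) q) (N q)"

definition coordinate_frame ::
  "(real \<times> real) set \<Rightarrow> (real \<times> real \<Rightarrow> real ^ 3) \<Rightarrow> (real \<times> real \<Rightarrow> real) \<Rightarrow> (real \<times> real \<Rightarrow> real ^ 3)
    \<Rightarrow> (real \<times> real \<Rightarrow> real ^ 2 ^ 2) \<Rightarrow> bool" where
  "coordinate_frame M \<phi> \<omega> N \<Phi> \<longleftrightarrow>
     timelike_immersion M \<phi> \<and> null_conformal M \<phi> \<omega> \<and> unit_normal M \<phi> N \<and> smooth M \<Phi> \<and>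
     (\<forall>q\<in>M. det (\<Phi> q) = 1 \<and>
        \<Phi> q ** quat_i ** matrix_inv (\<Phi> q) = quat (exp (- \<omega> q / 2) *\<^sub>R (pd_u \<phi> q - pd_v \<phi> q)) \<and>
        \<Phi> q ** quat_j ** matrix_inv (\<Phi> q) = quat (exp (- \<omega> q / 2) *\<^sub>R (pd_u \<phi> q + pd_v \<phi> q)) \<and>
        \<Phi> q ** quat_k ** matrix_inv (\<Phi> q) = quat (N q))"

definition conformal_frame ::
  "(real \<times> real) set \<Rightarrow> (real \<times> real \<Rightarrow> real ^ 3) \<Rightarrow> (real \<times> real \<Rightarrow> real) \<Rightarrow> (real \<times> real \<Rightarrow> real ^ 3)
    \<Rightarrow> (real \<times> real \<Rightarrow> real ^ 2 ^ 2) \<Rightarrow> bool" where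
  "conformal_frame M \<phi> \<omega> N \<Psi> \<longleftrightarrow>
     (\<exists>\<Phi>. coordinate_frame M \<phi> \<omega> N \<Phi> \<and> (\<forall>q\<in>M. \<Psi> q = exp (\<omega> q / 4) *\<^sub>R \<Phi> q))"

definition dirac_op :: "(real \<times> real \<Rightarrow> real ^ 2) \<Rightarrow> real \<times> real \<Rightarrow> real ^ 2" where
  "dirac_op \<psi> q = vector [pd_u (\<lambda>x. \<psi> x $ 2) q, - pd_v (\<lambda>x. \<psi> x $ 1) q]"

definition dirac_solution ::
  "(real \<times> real) set \<Rightarrow> (real \<times> real \<Rightarrow> real) \<Rightarrow> (real \<times> real \<Rightarrow> real ^ 2) \<Rightarrow> bool" where
  "dirac_solution M p \<psi> \<longleftrightarrow> smooth M \<psi> \<and> (\<forall>q\<in>M. dirac_op \<psi> q = p q *\<^sub>R \<psi> q)"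

definition spinor_matrix ::
  "(real \<times> real \<Rightarrow> real) \<Rightarrow> (real \<times> real \<Rightarrow> real) \<Rightarrow> (real \<times> real \<Rightarrow> real) \<Rightarrow> (real \<times> real \<Rightarrow> real)
    \<Rightarrow> real \<times> real \<Rightarrow> real ^ 2 ^ 2" where
  "spinor_matrix s1 s2 t1 t2 q = mat2 (s1 q) (- t2 q) (t1 q) (s2 q)"

definition spinor_surface ::
  "(real \<times> real) set \<Rightarrow> (real \<times> real \<Rightarrow> real) \<Rightarrow> (real \<times> real \<Rightarrow> real) \<Rightarrow> (real \<times> real \<Rightarrow> real)
    \<Rightarrow> (real \<times> real \<Rightarrow> real) \<Rightarrow> (real \<times> real \<Rightarrow> real ^ 3) \<Rightarrow> bool" where
  "spinor_surface M s1 s2 t1 t2 \<phi> \<longleftrightarrow>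
     is_line_integral M (\<lambda>q. 1/2 * ((s1 q)\<^sup>2 + (t1 q)\<^sup>2)) (\<lambda>q. - (1/2) * ((s2 q)\<^sup>2 + (t2 q)\<^sup>2)) (\<lambda>q. \<phi> q $ 1) \<and>
     is_line_integral M (\<lambda>q. 1/2 * ((s1 q)\<^sup>2 - (t1 q)\<^sup>2)) (\<lambda>q. 1/2 * ((s2 q)\<^sup>2 - (t2 q)\<^sup>2)) (\<lambda>q. \<phi> q $ 2) \<and>
     is_line_integral M (\<lambda>q. - (s1 q * t1 q)) (\<lambda>q. - (s2 q * t2 q)) (\<lambda>q. \<phi> q $ 3)"

end

theory Submission
  imports Defs "HOL-Complex_Analysis.Riemann_Mapping"
begin

text \<open>
  The Dirac equations say exactly that \<open>\<partial>\<^sub>v s\<^sub>1 = p t\<^sub>2\<close>, \<open>\<partial>\<^sub>u t\<^sub>2 = - p s\<^sub>1\<close>, \<open>\<partial>\<^sub>u s\<^sub>2 = p t\<^sub>1\<close>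
  and \<open>\<partial>\<^sub>v t\<^sub>1 = - p s\<^sub>2\<close>. They make the three 1-forms closed, with mixed derivative
  \<open>\<phi>\<^sub>u\<^sub>v = p V\<close> for \<open>V = (s\<^sub>1 t\<^sub>2 - t\<^sub>1 s\<^sub>2, s\<^sub>1 t\<^sub>2 + t\<^sub>1 s\<^sub>2, s\<^sub>1 s\<^sub>2 - t\<^sub>1 t\<^sub>2)\<close>. This \<open>V\<close> is normal to the surface and
  \<open>\<langle>V, V\<rangle> = (s\<^sub>1 s\<^sub>2 + t\<^sub>1 t\<^sub>2)\<^sup>2 = e\<^sup>\<omega>\<close>, so \<open>N = e\<^bsup>-\<omega>/2\<^esup> V\<close> is a unit normal and \<open>H\<close> can be read off.

  That closed forms are exact on a simply connected domain reduces, by the Riemann mapping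
  theorem, to the Poincare lemma on a disc or the whole plane, where
  \<open>f(x) = \<integral>\<^sub>0\<^sup>1 c(t x) \<bullet> x dt\<close> is a potential of a curl-free field \<open>c\<close>.
\<close>

subsection \<open>Calculus of partial derivatives\<close>

text \<open>The coordinate lines through \<open>q\<close> are affine with derivatives
  \<open>(h, 0)\<close> and \<open>(0, h)\<close>, so the chain rule applies.\<close>

lemma partial_eq_derivative:
  assumes "(f has_derivative D) (at q)"
  shows pd_u_eq_derivative: "pd_u f q = D (1, 0)" and pd_v_eq_derivative: "pd_v f q = D (0, 1)"
proof -
  have lin: "linear D"
    using assms has_derivative_linear by blast
  have "((\<lambda>x. (x, snd q)) has_derivative (\<lambda>h. (h, 0))) (at (fst q))"
    by (intro has_derivative_Pair has_derivative_ident has_derivative_const)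
  from has_derivative_compose[OF this, of f D] assms
  have "((\<lambda>x. f (x, snd q)) has_derivative (\<lambda>h. D (h, 0))) (at (fst q))"
    by simp
  moreover have "(\<lambda>h. D (h, 0)) = (\<lambda>h. h *\<^sub>R D (1, 0))"
    by (simp add: linear_scale[OF lin, symmetric])
  ultimately show "pd_u f q = D (1, 0)"
    unfolding pd_u_def by (simp add: vector_derivative_at has_vector_derivative_def)
  have "((\<lambda>y. (fst q, y)) has_derivative (\<lambda>h. (0, h))) (at (snd q))"
    by (intro has_derivative_Pair has_derivative_ident has_derivative_const)
  from has_derivative_compose[OF this, of f D] assms
  have "((\<lambda>y. f (fst q, y)) has_derivative (\<lambda>h. D (0, h))) (at (snd q))"
    by simp
  moreover have "(\<lambda>h. D (0, h)) = (\<lambda>h. h *\<^sub>R D (0, 1))"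
    by (simp add: linear_scale[OF lin, symmetric])
  ultimately show "pd_v f q = D (0, 1)"
    unfolding pd_v_def by (simp add: vector_derivative_at has_vector_derivative_def)
qed

lemma has_derivative_partials:
  assumes "f differentiable (at q)"
  shows "(f has_derivative (\<lambda>h. fst h *\<^sub>R pd_u f q + snd h *\<^sub>R pd_v f q)) (at q)"
proof -
  obtain D where D: "(f has_derivative D) (at q)"
    using assms differentiable_def by blast
  have lin: "linear D"
    using D has_derivative_linear by blast
  have "D h = fst h *\<^sub>R D (1, 0) + snd h *\<^sub>R D (0, 1)" for h
    unfolding linear_scale[OF lin, symmetric] linear_add[OF lin, symmetric] by simp
  then have "D = (\<lambda>h. fst h *\<^sub>R pd_u f q + snd h *\<^sub>R pd_v f q)"
    unfolding partial_eq_derivative[OF D] by (rule ext)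
  with D show ?thesis
    by simp
qed

section \<open>Closure properties of the classes C^k\<close>

lemma C_class_cong:
  assumes "open M" "\<And>q. q \<in> M \<Longrightarrow> f q = g q" "C_class k M f"
  shows "C_class k M g"
  using assms(2,3)
proof (induction k arbitrary: f g)
  case 0
  then show ?case
    by (metis C_class.simps(1) continuous_on_cong)
next
  case (Suc k)
  have f: "(f has_derivative frechet_derivative f (at q)) (at q)" if "q \<in> M" for q
    using Suc.prems that by (simp flip: frechet_derivative_works)
  \<comment> \<open>Openness of \<open>M\<close> makes \<open>f\<close> and \<open>g\<close> agree
    near \<open>q\<close>, so they share their derivative and hence both partials.\<close>
  have g: "(g has_derivative frechet_derivative f (at q)) (at q)" if "q \<in> M" for q
    using has_derivative_transform_within_open[OF f[OF that] assms(1) that] Suc.prems(1) by simp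
  have eq: "pd_u f q = pd_u g q" "pd_v f q = pd_v g q" if "q \<in> M" for q
    unfolding partial_eq_derivative[OF f[OF that]] partial_eq_derivative[OF g[OF that]] by (rule refl)+
  have "C_class k M (pd_u g)"
    by (rule Suc.IH[OF eq(1)]) (use Suc.prems in simp_all)
  moreover have "C_class k M (pd_v g)"
    by (rule Suc.IH[OF eq(2)]) (use Suc.prems in simp_all)
  ultimately show ?case
    using g by (auto simp: differentiable_def)
qed

text \<open>Reduces C^(k+1) to the two columns of an explicit derivative. The inductions for sums,
  products and elementary functions feed in the derivative rule of the operation.\<close>

lemma C_class_Suc_iff:
  assumes "open M" "\<And>q. q \<in> M \<Longrightarrow> (f has_derivative D q) (at q)"
  shows "C_class (Suc k) M f \<longleftrightarrow> C_class k M (\<lambda>q. D q (1, 0)) \<and> C_class k M (\<lambda>q. D q (0, 1))"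
proof -
  have eq: "pd_u f q = D q (1, 0)" "pd_v f q = D q (0, 1)" if "q \<in> M" for q
    by (fact partial_eq_derivative[OF assms(2)[OF that]])+
  have "C_class k M (pd_u f) \<longleftrightarrow> C_class k M (\<lambda>q. D q (1, 0))"
    by (rule iffI; erule C_class_cong[OF assms(1), rotated]) (simp_all add: eq)
  moreover have "C_class k M (pd_v f) \<longleftrightarrow> C_class k M (\<lambda>q. D q (0, 1))"
    by (rule iffI; erule C_class_cong[OF assms(1), rotated]) (simp_all add: eq)
  moreover have "\<forall>q\<in>M. f differentiable (at q)"
    using assms(2) by (blast intro: differentiableI)
  ultimately show ?thesis
    by simp
qed

text \<open>At the bottom this is continuity of differentiable functions; higher up the claim passes
  to the two partials.\<close>

lemma C_class_SucD: "C_class (Suc k) M f \<Longrightarrow> C_class k M f"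
proof (induction k arbitrary: f)
  case 0
  then show ?case
    by (simp add: continuous_at_imp_continuous_on differentiable_imp_continuous_within)
next
  case (Suc k)
  have "C_class (Suc k) M (pd_u f)" "C_class (Suc k) M (pd_v f)"
    using Suc.prems by simp_all
  from this[THEN Suc.IH] show ?case
    using Suc.prems by simp
qed

lemma C_class_Suc_derivative:
  assumes "C_class (Suc k) M f" "q \<in> M"
  shows "(f has_derivative (\<lambda>h. fst h *\<^sub>R pd_u f q + snd h *\<^sub>R pd_v f q)) (at q)"
  using assms by (intro has_derivative_partials) simp

lemma C_class_const: "C_class k M (\<lambda>q. c)"
proof (induction k arbitrary: c)
  case (Suc k)
  have "pd_u (\<lambda>q. c) = (\<lambda>q. 0)" "pd_v (\<lambda>q. c) = (\<lambda>q. 0)"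
    by (auto simp: fun_eq_iff intro: partial_eq_derivative[OF has_derivative_const])
  then show ?case
    using Suc by simp
qed simp

lemma C_class_add:
  assumes "open M"
  shows "C_class k M f \<Longrightarrow> C_class k M g \<Longrightarrow> C_class k M (\<lambda>q. f q + g q)"
proof (induction k arbitrary: f g)
  case 0
  then show ?case
    by (simp add: continuous_on_add)
next
  case (Suc k)
  show ?case
    using Suc
    by (subst C_class_Suc_iff[OF assms has_derivative_add[OF C_class_Suc_derivative[OF Suc.prems(1)]
      C_class_Suc_derivative[OF Suc.prems(2)]]]) auto
qed

lemma (in bounded_linear) C_class_linear:
  assumes "open M"
  shows "C_class k M g \<Longrightarrow> C_class k M (\<lambda>q. f (g q))"
proof (induction k arbitrary: g)
  case 0
  then show ?case
    by (simp add: continuous_on)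
next
  case (Suc k)
  show ?case
    using Suc by (subst C_class_Suc_iff[OF assms has_derivative[OF C_class_Suc_derivative[OF Suc.prems]]]) auto
qed

lemma (in bounded_bilinear) C_class_bilinear:
  assumes "open M"
  shows "C_class k M f \<Longrightarrow> C_class k M g \<Longrightarrow> C_class k M (\<lambda>q. prod (f q) (g q))"
proof (induction k arbitrary: f g)
  case 0
  then show ?case
    by (simp add: continuous_on)
next
  case (Suc k)
  \<comment> \<open>The product rule leaves one factor undifferentiated, so both factors are also
    needed one class lower.\<close>
  then have "C_class k M f" "C_class k M g"
    using C_class_SucD by blast+
  with Suc show ?case
    by (subst C_class_Suc_iff[OF assms FDERIV[OF C_class_Suc_derivative[OF Suc.prems(1)]
      C_class_Suc_derivative[OF Suc.prems(2)]]]) (simp_all add: C_class_add assms)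
qed

lemma C_class_exp:
  fixes f :: "real \<times> real \<Rightarrow> real"
  assumes "open M"
  shows "C_class k M f \<Longrightarrow> C_class k M (\<lambda>q. exp (f q))"
proof (induction k)
  case 0
  then show ?case
    by (simp add: continuous_on_exp)
next
  case (Suc k)
  \<comment> \<open>The derivative of \<open>exp (f q)\<close> contains this function again as a
    factor; the induction hypothesis covers it.\<close>
  then have "C_class k M (\<lambda>q. exp (f q))"
    using C_class_SucD by blast
  with Suc show ?case
    by (subst C_class_Suc_iff[OF assms has_derivative_exp[OF C_class_Suc_derivative[OF Suc.prems]]])
      (simp_all add: bounded_bilinear.C_class_bilinear[OF bounded_bilinear_mult assms])
qed

lemma C_class_inverse:
  fixes f :: "real \<times> real \<Rightarrow> real"
  assumes "open M" "\<And>q. q \<in> M \<Longrightarrow> f q \<noteq> 0"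
  shows "C_class k M f \<Longrightarrow> C_class k M (\<lambda>q. inverse (f q))"
proof (induction k)
  case 0
  then show ?case
    using assms by (simp add: continuous_on_inverse)
next
  case (Suc k)
  then have "C_class k M (\<lambda>q. inverse (f q))"
    using C_class_SucD by blast
  with Suc show ?case
    by (subst C_class_Suc_iff[OF assms(1) Deriv.has_derivative_inverse[OF assms(2)
        C_class_Suc_derivative[OF Suc.prems]]])
      (simp_all add: bounded_bilinear.C_class_bilinear[OF bounded_bilinear_mult assms(1)]
        bounded_linear.C_class_linear[OF bounded_linear_minus[OF bounded_linear_ident] assms(1)])
qed

lemma C_class_ln:
  fixes f :: "real \<times> real \<Rightarrow> real"
  assumes "open M" "\<And>q. q \<in> M \<Longrightarrow> f q > 0"
  shows "C_class k M f \<Longrightarrow> C_class k M (\<lambda>q. ln (f q))"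
proof (induction k)
  have nonzero: "f q \<noteq> 0" if "q \<in> M" for q
    using assms(2)[OF that] by simp
  case 0
  then show ?case
    using nonzero by (simp add: continuous_on_ln)
next
  case (Suc k)
  have "f q \<noteq> 0" if "q \<in> M" for q
    using assms(2)[OF that] by simp
  then have "C_class k M (\<lambda>q. inverse (f q))"
    using C_class_inverse[OF assms(1)] C_class_SucD[OF Suc.prems] by blast
  with Suc show ?case
    by (subst C_class_Suc_iff[OF assms(1) has_derivative_ln[OF assms(2) C_class_Suc_derivative[OF Suc.prems]]])
      (simp_all add: bounded_bilinear.C_class_bilinear[OF bounded_bilinear_mult assms(1)])
qed

text \<open>A vector-valued function is the finite sum of its components pushed along the axes, and
  each \<open>axis i\<close> is bounded linear. The general entry type allows a second application
  for matrices.\<close>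

lemma C_class_vec:
  fixes f :: "real \<times> real \<Rightarrow> 'a::euclidean_space ^ 'n"
  assumes "open M" "\<And>i. C_class k M (\<lambda>q. f q $ i)"
  shows "C_class k M f"
proof -
  have lin: "bounded_linear (axis i :: 'a \<Rightarrow> 'a ^ 'n)" for i
  proof -
    have "linear (axis i :: 'a \<Rightarrow> 'a ^ 'n)"
      by (rule linearI) (auto simp: axis_def vec_eq_iff)
    then show ?thesis
      by (simp add: linear_conv_bounded_linear)
  qed
  have "C_class k M (\<lambda>q. \<Sum>i\<in>I. axis i (f q $ i))" for I :: "'n set"
  proof (induction I rule: finite_induct[OF finite])
    case 1
    show ?case
      by (simp add: C_class_const)
  next
    case (2 i I)
    then show ?case
      using C_class_add[OF assms(1) bounded_linear.C_class_linear[OF lin assms] 2(3)] by simp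
  qed
  moreover have "(\<lambda>q. \<Sum>i\<in>UNIV. axis i (f q $ i)) = f"
    by (rule ext) (simp add: vec_eq_iff axis_def)
  ultimately show ?thesis
    by metis
qed

lemma smooth_intros:
  fixes f g :: "real \<times> real \<Rightarrow> 'a::real_normed_vector" and a b :: "real \<times> real \<Rightarrow> real"
    and F :: "real \<times> real \<Rightarrow> 'b::euclidean_space ^ 'n"
  assumes "open M"
  shows smooth_const: "smooth M (\<lambda>q. c)"
    and smooth_add: "smooth M f \<Longrightarrow> smooth M g \<Longrightarrow> smooth M (\<lambda>q. f q + g q)"
    and smooth_minus: "smooth M f \<Longrightarrow> smooth M (\<lambda>q. - f q)"
    and smooth_diff: "smooth M f \<Longrightarrow> smooth M g \<Longrightarrow> smooth M (\<lambda>q. f q - g q)"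
    and smooth_mult: "smooth M a \<Longrightarrow> smooth M b \<Longrightarrow> smooth M (\<lambda>q. a q * b q)"
    and smooth_scaleR: "smooth M a \<Longrightarrow> smooth M f \<Longrightarrow> smooth M (\<lambda>q. a q *\<^sub>R f q)"
    and smooth_power2: "smooth M a \<Longrightarrow> smooth M (\<lambda>q. (a q)\<^sup>2)"
    and smooth_exp: "smooth M a \<Longrightarrow> smooth M (\<lambda>q. exp (a q))"
    and smooth_ln: "smooth M a \<Longrightarrow> (\<And>q. q \<in> M \<Longrightarrow> a q > 0) \<Longrightarrow> smooth M (\<lambda>q. ln (a q))"
    and smooth_vec: "(\<And>i. smooth M (\<lambda>q. F q $ i)) \<Longrightarrow> smooth M F"
    and smooth_component: "smooth M F \<Longrightarrow> smooth M (\<lambda>q. F q $ i)"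
proof -
  note neg = bounded_linear.C_class_linear[OF bounded_linear_minus[OF bounded_linear_ident] assms]
  note mult = bounded_bilinear.C_class_bilinear[OF bounded_bilinear_mult assms]
  show "smooth M (\<lambda>q. c)"
    by (simp add: smooth_def C_class_const)
  show "smooth M f \<Longrightarrow> smooth M g \<Longrightarrow> smooth M (\<lambda>q. f q + g q)"
    by (simp add: smooth_def C_class_add assms)
  show "smooth M f \<Longrightarrow> smooth M (\<lambda>q. - f q)"
    by (simp add: smooth_def neg)
  show "smooth M f \<Longrightarrow> smooth M g \<Longrightarrow> smooth M (\<lambda>q. f q - g q)"
    using C_class_add[OF assms _ neg, of _ f g] by (simp add: smooth_def)
  show "smooth M a \<Longrightarrow> smooth M b \<Longrightarrow> smooth M (\<lambda>q. a q * b q)"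
    by (simp add: smooth_def mult)
  show "smooth M a \<Longrightarrow> smooth M f \<Longrightarrow> smooth M (\<lambda>q. a q *\<^sub>R f q)"
    by (simp add: smooth_def bounded_bilinear.C_class_bilinear[OF bounded_bilinear_scaleR assms])
  show "smooth M a \<Longrightarrow> smooth M (\<lambda>q. (a q)\<^sup>2)"
    by (simp add: smooth_def power2_eq_square mult)
  show "smooth M a \<Longrightarrow> smooth M (\<lambda>q. exp (a q))"
    by (simp add: smooth_def C_class_exp assms)
  show "smooth M a \<Longrightarrow> (\<And>q. q \<in> M \<Longrightarrow> a q > 0) \<Longrightarrow> smooth M (\<lambda>q. ln (a q))"
    by (simp add: smooth_def C_class_ln assms)
  show "(\<And>i. smooth M (\<lambda>q. F q $ i)) \<Longrightarrow> smooth M F"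
    by (simp add: smooth_def C_class_vec assms)
  show "smooth M F \<Longrightarrow> smooth M (\<lambda>q. F q $ i)"
    by (simp add: smooth_def bounded_linear.C_class_linear[OF bounded_linear_vec_nth assms])
qed

lemma smooth_derivative:
  assumes "smooth M f" "q \<in> M"
  shows "(f has_derivative (\<lambda>h. fst h *\<^sub>R pd_u f q + snd h *\<^sub>R pd_v f q)) (at q)"
  using assms C_class_Suc_derivative[of 0 M f q] unfolding smooth_def by blast

text \<open>Serves for the surface itself, which is known only through its derivative: smooth
  columns give every C^(k+1), hence every C^k.\<close>

lemma smoothI:
  assumes "open M" "\<And>q. q \<in> M \<Longrightarrow> (f has_derivative D q) (at q)"
    "smooth M (\<lambda>q. D q (1, 0))" "smooth M (\<lambda>q. D q (0, 1))"
  shows "smooth M f"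
proof -
  have "C_class (Suc k) M f" for k
    by (rule C_class_Suc_iff[OF assms(1,2), THEN iffD2]) (use assms(3,4) in \<open>simp_all add: smooth_def\<close>)
  then show ?thesis
    unfolding smooth_def using C_class_SucD by blast
qed

section \<open>Componentwise derivatives and rules for partial derivatives\<close>

lemma has_derivative_vec:
  fixes F :: "'a::real_normed_vector \<Rightarrow> real ^ 'n"
  assumes "\<And>i. ((\<lambda>x. F x $ i) has_derivative (\<lambda>h. D h $ i)) (at x)"
  shows "(F has_derivative D) (at x)"
  using assms by (auto simp: has_derivative_componentwise_within[of F] Basis_vec_def inner_axis)

lemma partial_nth:
  assumes "F differentiable (at q)"
  shows pd_u_nth: "pd_u (\<lambda>q. F q $ i) q = pd_u F q $ i"
    and pd_v_nth: "pd_v (\<lambda>q. F q $ i) q = pd_v F q $ i"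
  using partial_eq_derivative[OF bounded_linear.has_derivative[OF bounded_linear_vec_nth
        has_derivative_partials[OF assms]], of i]
  by simp_all

lemma partial_rules:
  fixes f g :: "real \<times> real \<Rightarrow> real"
  assumes "f differentiable (at q)" "g differentiable (at q)"
  shows "pd_u (\<lambda>q. f q + g q) q = pd_u f q + pd_u g q" "pd_v (\<lambda>q. f q + g q) q = pd_v f q + pd_v g q"
    and "pd_u (\<lambda>q. f q - g q) q = pd_u f q - pd_u g q" "pd_v (\<lambda>q. f q - g q) q = pd_v f q - pd_v g q"
    and "pd_u (\<lambda>q. f q * g q) q = f q * pd_u g q + pd_u f q * g q"
      "pd_v (\<lambda>q. f q * g q) q = f q * pd_v g q + pd_v f q * g q"
  using partial_eq_derivative[OF has_derivative_add[OF assms[THEN has_derivative_partials]]]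
    partial_eq_derivative[OF has_derivative_diff[OF assms[THEN has_derivative_partials]]]
    partial_eq_derivative[OF has_derivative_mult[OF assms[THEN has_derivative_partials]]]
  by simp_all

lemma partial_minus:
  assumes "f differentiable (at q)"
  shows pd_u_minus: "pd_u (\<lambda>q. - f q) q = - pd_u f q" and pd_v_minus: "pd_v (\<lambda>q. - f q) q = - pd_v f q"
  using partial_eq_derivative[OF has_derivative_minus[OF has_derivative_partials[OF assms]]]
  by simp_all

lemma partial_divide:
  fixes f :: "real \<times> real \<Rightarrow> real"
  assumes "f differentiable (at q)"
  shows "pd_u (\<lambda>q. f q / c) q = pd_u f q / c" "pd_v (\<lambda>q. f q / c) q = pd_v f q / c"
  using partial_eq_derivative[OF bounded_linear.has_derivative[OF bounded_linear_divide
        has_derivative_partials[OF assms]]]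
  by simp_all

text \<open>Needed for mixed derivatives: a formula for a first partial that holds only on
  \<open>M\<close> may be differentiated once more, because \<open>M\<close> is open.\<close>

lemma pd_v_cong:
  assumes "open M" "q \<in> M" "\<And>x. x \<in> M \<Longrightarrow> f x = g x" "f differentiable (at q)"
  shows "pd_v f q = pd_v g q"
proof -
  have "(g has_derivative (\<lambda>h. fst h *\<^sub>R pd_u f q + snd h *\<^sub>R pd_v f q)) (at q)"
    using has_derivative_transform_within_open[OF has_derivative_partials[OF assms(4)] assms(1,2)] assms(3)
    by simp
  from pd_v_eq_derivative[OF this] show ?thesis
    by simp
qed

lemma smooth_imp_differentiable: "smooth M f \<Longrightarrow> q \<in> M \<Longrightarrow> f differentiable (at q)"
  using smooth_derivative differentiableI by blast

lemma smooth_imp_continuous_on: "smooth M f \<Longrightarrow> continuous_on M f"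
  using C_class.simps(1) unfolding smooth_def by blast

lemma smooth_vector3:
  fixes a b c :: "real \<times> real \<Rightarrow> real"
  assumes "open M" "smooth M a" "smooth M b" "smooth M c"
  shows "smooth M (\<lambda>q. vector [a q, b q, c q] :: real ^ 3)"
proof (rule smooth_vec[OF assms(1)])
  fix i :: 3
  show "smooth M (\<lambda>q. (vector [a q, b q, c q] :: real ^ 3) $ i)"
    using exhaust_3[of i] assms by auto
qed

lemma smooth_mat2:
  assumes "open M" "smooth M a" "smooth M b" "smooth M c" "smooth M d"
  shows "smooth M (\<lambda>q. mat2 (a q) (b q) (c q) (d q))"
proof (rule smooth_vec[OF assms(1)], rule smooth_vec[OF assms(1)])
  fix i j :: 2
  show "smooth M (\<lambda>q. mat2 (a q) (b q) (c q) (d q) $ i $ j)"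
    using exhaust_2[of i] exhaust_2[of j] assms by (auto simp: mat2_def)
qed

subsection \<open>Line integrals and exactness of closed forms\<close>

text \<open>Integrating along the straight segment from \<open>q\<close> to a nearby
  \<open>y\<close>, the increment of \<open>f\<close> differs from the linear term by at most the
  oscillation of the coefficients times the length.\<close>

lemma is_line_integral_imp_derivative:
  assumes "open M" "continuous_on M a" "continuous_on M b" "is_line_integral M a b f" "q \<in> M"
  shows "(f has_derivative (\<lambda>h. a q * fst h + b q * snd h)) (at q)"
  unfolding has_derivative_at_alt
proof (intro conjI allI impI)
  show "bounded_linear (\<lambda>h. a q * fst h + b q * snd h)"
    by (intro bounded_linear_add bounded_linear_const_mult bounded_linear_fst bounded_linear_snd)
  fix e :: real
  assume "e > 0"
  \<comment> \<open>Packing the coefficients into a vector field turns the integrand into an inner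
    product, ready for Cauchy-Schwarz.\<close>
  define c where "c x = (a x, b x)" for x
  have "continuous_on M c"
    unfolding c_def by (intro continuous_on_Pair assms)
  then have "isCont c q"
    using assms continuous_on_eq_continuous_at by blast
  then obtain d1 where d1: "d1 > 0" "\<And>x. dist x q < d1 \<Longrightarrow> dist (c x) (c q) < e"
    using \<open>e > 0\<close> unfolding continuous_at_eps_delta by metis
  obtain d2 where d2: "d2 > 0" "ball q d2 \<subseteq> M"
    using assms openE by blast
  have "norm (f y - f q - (a q * fst (y - q) + b q * snd (y - q))) \<le> e * norm (y - q)"
    if y: "norm (y - q) < min d1 d2" for y
  proof -
    have near: "norm (linepath q y t - q) < min d1 d2" if "t \<in> {0..1}" for t
    proof -
      have "linepath q y t - q = t *\<^sub>R (y - q)"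
        by (simp add: linepath_def algebra_simps)
      then have "norm (linepath q y t - q) \<le> norm (y - q)"
        using that mult_right_mono[of t 1 "norm (y - q)"] by (simp add: norm_minus_commute)
      with y show ?thesis
        by linarith
    qed
    have "path_image (linepath q y) \<subseteq> M"
      using near d2 unfolding path_image_def by (force simp: dist_norm norm_minus_commute)
    then have "((\<lambda>t. c (linepath q y t) \<bullet> (y - q)) has_integral f y - f q) {0..1}"
      using assms(4)[unfolded is_line_integral_def, rule_format, of "linepath q y"]
      by (simp add: c_def inner_prod_def)
    \<comment> \<open>The constant field \<open>c q\<close> integrates along the segment to exactly
      the linear term, so the difference of the integrals is the error.\<close>
    from has_integral_diff[OF this has_integral_const_real[of "c q \<bullet> (y - q)" 0 1]]
    have "((\<lambda>t. (c (linepath q y t) - c q) \<bullet> (y - q)) has_integral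
        f y - f q - c q \<bullet> (y - q)) (cbox 0 1)"
      by (simp add: inner_diff_left)
    then have "norm (f y - f q - c q \<bullet> (y - q)) \<le> (e * norm (y - q)) * measure lborel (cbox 0 (1::real))"
    proof (rule has_integral_bound[rotated])
      fix t :: real
      assume "t \<in> cbox 0 1"
      then have "norm (c (linepath q y t) - c q) \<le> e"
        using near[of t] d1(2)[of "linepath q y t"] by (simp add: dist_norm)
      then show "norm ((c (linepath q y t) - c q) \<bullet> (y - q)) \<le> e * norm (y - q)"
        using Cauchy_Schwarz_ineq2[of "c (linepath q y t) - c q" "y - q"]
          mult_right_mono[of "norm (c (linepath q y t) - c q)" e "norm (y - q)"] by simp
    qed (use \<open>e > 0\<close> in simp)
    then show ?thesis
      by (simp add: c_def inner_prod_def)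
  qed
  moreover have "min d1 d2 > 0"
    using d1 d2 by simp
  ultimately show "\<exists>d>0. \<forall>y. norm (y - q) < d \<longrightarrow>
      norm (f y - f q - (a q * fst (y - q) + b q * snd (y - q))) \<le> e * norm (y - q)"
    by blast
qed

lemma is_line_integralI:
  assumes "\<And>q. q \<in> M \<Longrightarrow> (f has_derivative (\<lambda>h. a q * fst h + b q * snd h)) (at q)"
  shows "is_line_integral M a b f"
  unfolding is_line_integral_def
proof (intro allI impI, elim conjE)
  fix \<gamma> :: "real \<Rightarrow> real \<times> real"
  assume \<gamma>: "valid_path \<gamma>" "path_image \<gamma> \<subseteq> M"
  then obtain S where S: "finite S" "\<gamma> C1_differentiable_on ({0..1} - S)" "continuous_on {0..1} \<gamma>"
    unfolding valid_path_def piecewise_C1_differentiable_on_def by blast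
  have in_M: "\<gamma> t \<in> M" if "t \<in> {0..1}" for t
    using that \<gamma>(2) unfolding path_image_def by blast
  have "((\<lambda>t. a (\<gamma> t) * fst (vector_derivative \<gamma> (at t)) + b (\<gamma> t) * snd (vector_derivative \<gamma> (at t)))
      has_integral (f \<circ> \<gamma>) 1 - (f \<circ> \<gamma>) 0) {0..1}"
  \<comment> \<open>The corners of the path lie in the finite set \<open>S\<close>, where continuity
    of \<open>f \<circ> \<gamma>\<close> is enough.\<close>
  proof (rule fundamental_theorem_of_calculus_interior_strong[OF S(1)])
    fix t
    assume t: "t \<in> {0<..<1} - S"
    then have "(\<gamma> has_vector_derivative vector_derivative \<gamma> (at t)) (at t)"
      using S(2) unfolding C1_differentiable_on_eq by (simp add: vector_derivative_works)
    then have "(\<gamma> has_derivative (\<lambda>h. h *\<^sub>R vector_derivative \<gamma> (at t))) (at t)"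
      by (simp add: has_vector_derivative_def)
    from has_derivative_compose[OF this assms] t
    have "((\<lambda>x. f (\<gamma> x)) has_derivative (\<lambda>h. a (\<gamma> t) * fst (h *\<^sub>R vector_derivative \<gamma> (at t))
        + b (\<gamma> t) * snd (h *\<^sub>R vector_derivative \<gamma> (at t)))) (at t)"
      using in_M by simp
    then show "(f \<circ> \<gamma> has_vector_derivative
        a (\<gamma> t) * fst (vector_derivative \<gamma> (at t)) + b (\<gamma> t) * snd (vector_derivative \<gamma> (at t))) (at t)"
      by (simp add: has_vector_derivative_def o_def algebra_simps)
  next
    have "continuous_on M f"
      using assms has_derivative_continuous continuous_at_imp_continuous_on by blast
    then show "continuous_on {0..1} (f \<circ> \<gamma>)"
      using S(3) in_M by (intro continuous_on_compose) (auto intro: continuous_on_subset)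
  qed simp
  then show "((\<lambda>t. a (\<gamma> t) * fst (vector_derivative \<gamma> (at t)) + b (\<gamma> t) * snd (vector_derivative \<gamma> (at t)))
      has_integral f (pathfinish \<gamma>) - f (pathstart \<gamma>)) {0..1}"
    by (simp add: pathfinish_def pathstart_def)
qed

text \<open>The radial integral is differentiated under the integral sign. By symmetry of
  \<open>c'\<close> the result integrates the t-derivative of
  \<open>t *\<^sub>R c (t *\<^sub>R x)\<close> over \<open>[0, 1]\<close>, which leaves
  \<open>c x\<close>.\<close>

lemma convex_curl_free_imp_gradient:
  fixes c :: "'a::euclidean_space \<Rightarrow> 'a"
  assumes "open S" "convex S" "0 \<in> S"
    and deriv: "\<And>x. x \<in> S \<Longrightarrow> (c has_derivative c' x) (at x)"
    and cont: "\<And>h. continuous_on S (\<lambda>x. c' x h)"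
    and sym: "\<And>x h k. x \<in> S \<Longrightarrow> c' x h \<bullet> k = c' x k \<bullet> h"
  shows "\<exists>f. \<forall>x\<in>S. (f has_derivative (\<lambda>h. c x \<bullet> h)) (at x)"
proof -
  \<comment> \<open>The Leibniz rule asks for a derivative that is continuous as a bounded linear
    map; in finite dimension this follows from continuity in each direction.\<close>
  define C where "C x = Blinfun (c' x)" for x
  have C: "blinfun_apply (C x) = c' x" if "x \<in> S" for x
    unfolding C_def using deriv[OF that] by (simp add: bounded_linear_Blinfun_apply has_derivative_bounded_linear)
  have cont_C: "continuous_on S C"
    by (rule continuous_on_blinfun_componentwise) (use cont C in \<open>simp cong: continuous_on_cong\<close>)
  have cont_c: "continuous_on S c"
    using deriv has_derivative_continuous continuous_at_imp_continuous_on by blast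
  have scale: "t *\<^sub>R x \<in> S" if "x \<in> S" "t \<in> cbox 0 1" for x t
    using convexD_alt[OF assms(2,3) that(1), of t] that(2) by simp
  \<comment> \<open>\<open>D x t\<close> is the derivative in \<open>x\<close> of the integrand
    \<open>c (t *\<^sub>R x) \<bullet> x\<close>.\<close>
  define D where
    "D x t = blinfun_inner_right (c (t *\<^sub>R x)) + t *\<^sub>R (blinfun_inner_left x o\<^sub>L C (t *\<^sub>R x))" for x t
  have D: "(D x has_integral blinfun_inner_right (c x)) (cbox 0 1)" if x: "x \<in> S" for x
  proof -
    have "((\<lambda>t. blinfun_inner_right (t *\<^sub>R c (t *\<^sub>R x))) has_vector_derivative D x t) (at t within {0..1})"
      if t: "t \<in> {0..1}" for t
    proof -
      have tx: "t *\<^sub>R x \<in> S"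
        using scale x t by simp
      have "((\<lambda>s. s *\<^sub>R x) has_derivative (\<lambda>h. h *\<^sub>R x)) (at t within {0..1})"
        by (auto intro!: derivative_eq_intros)
      from has_derivative_compose[OF this deriv[OF tx]]
      have "((\<lambda>s. c (s *\<^sub>R x)) has_vector_derivative c' (t *\<^sub>R x) x) (at t within {0..1})"
        using linear_scale[OF has_derivative_linear[OF deriv[OF tx]]]
        by (simp add: has_vector_derivative_def)
      then have "((\<lambda>s. s *\<^sub>R c (s *\<^sub>R x)) has_vector_derivative c (t *\<^sub>R x) + t *\<^sub>R c' (t *\<^sub>R x) x)
          (at t within {0..1})"
        by (auto intro!: derivative_eq_intros)
      from bounded_linear.has_vector_derivative[OF bounded_linear_blinfun_inner_right this]
      have "((\<lambda>t. blinfun_inner_right (t *\<^sub>R c (t *\<^sub>R x))) has_vector_derivative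
          blinfun_inner_right (c (t *\<^sub>R x) + t *\<^sub>R c' (t *\<^sub>R x) x)) (at t within {0..1})" .
      \<comment> \<open>Symmetry exchanges \<open>x\<close> with the test vector in the second term
        of \<open>D x t\<close>, so \<open>D x t\<close> becomes a t-derivative.\<close>
      moreover have "blinfun_inner_right (c (t *\<^sub>R x) + t *\<^sub>R c' (t *\<^sub>R x) x) = D x t"
        unfolding D_def using sym[OF tx]
        by (intro blinfun_eqI) (simp add: blinfun.bilinear_simps inner_add_left C[OF tx])
      ultimately show ?thesis
        by simp
    qed
    from fundamental_theorem_of_calculus[OF _ this] show ?thesis
      by (simp add: linear_0[OF bounded_linear.linear[OF bounded_linear_blinfun_inner_right]])
  qed
  define f where "f x = integral (cbox 0 1) (\<lambda>t. c (t *\<^sub>R x) \<bullet> x)" for x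
  have "(f has_derivative blinfun_apply (integral (cbox 0 1) (D x))) (at x within S)" if "x \<in> S" for x
    unfolding f_def
  proof (rule leibniz_rule)
    fix y :: 'a and t :: real
    assume yt: "y \<in> S" "t \<in> cbox 0 1"
    have ty: "t *\<^sub>R y \<in> S"
      using scale yt by blast
    have "((\<lambda>y. t *\<^sub>R y) has_derivative (\<lambda>h. t *\<^sub>R h)) (at y within S)"
      by (auto intro!: derivative_eq_intros)
    note has_derivative_inner[OF has_derivative_compose[OF this deriv[OF ty]] has_derivative_ident]
    moreover have "blinfun_apply (D y t) = (\<lambda>h. c (t *\<^sub>R y) \<bullet> h + c' (t *\<^sub>R y) (t *\<^sub>R h) \<bullet> y)"
      using linear_scale[OF has_derivative_linear[OF deriv[OF ty]]]
      by (simp add: D_def blinfun.bilinear_simps C[OF ty] fun_eq_iff)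
    ultimately show "((\<lambda>y. c (t *\<^sub>R y) \<bullet> y) has_derivative blinfun_apply (D y t)) (at y within S)"
      by simp
  next
    fix y assume "y \<in> S"
    then have "continuous_on (cbox 0 1) (\<lambda>t. c (t *\<^sub>R y) \<bullet> y)"
      using scale by (intro continuous_intros continuous_on_compose2[OF cont_c]) auto
    then show "(\<lambda>t. c (t *\<^sub>R y) \<bullet> y) integrable_on cbox 0 1"
      using integrable_continuous by blast
  next
    have "continuous_on (S \<times> cbox 0 1) (\<lambda>z. c (snd z *\<^sub>R fst z))"
      "continuous_on (S \<times> cbox 0 1) (\<lambda>z. C (snd z *\<^sub>R fst z))"
      using scale by (auto intro!: continuous_intros continuous_on_compose2[OF cont_c]
          continuous_on_compose2[OF cont_C])
    then show "continuous_on (S \<times> cbox 0 1) (\<lambda>(y, t). D y t)"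
      unfolding D_def case_prod_unfold by (intro continuous_intros)
  qed (use that assms in auto)
  then have "(f has_derivative blinfun_apply (blinfun_inner_right (c x))) (at x)" if "x \<in> S" for x
    using that at_within_open[OF that assms(1)] integral_unique[OF D[OF that]] by metis
  then show ?thesis
    unfolding blinfun_inner_right.rep_eq by blast
qed

lemma simply_connected_curl_free_imp_gradient:
  fixes c :: "complex \<Rightarrow> complex"
  assumes "open S" "simply_connected S"
    and deriv: "\<And>x. x \<in> S \<Longrightarrow> (c has_derivative c' x) (at x)"
    and cont: "\<And>h. continuous_on S (\<lambda>x. c' x h)"
    and sym: "\<And>x h k. x \<in> S \<Longrightarrow> c' x h \<bullet> k = c' x k \<bullet> h"
  shows "\<exists>f. \<forall>x\<in>S. (f has_derivative (\<lambda>h. c x \<bullet> h)) (at x)"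
proof -
  consider "S = {}" | "S = UNIV" | (disc) r g where
      "r holomorphic_on S" "g holomorphic_on ball 0 1"
      "\<And>z. z \<in> S \<Longrightarrow> r z \<in> ball 0 1 \<and> g (r z) = z"
      "\<And>z. z \<in> ball 0 1 \<Longrightarrow> g z \<in> S \<and> r (g z) = z"
    using Riemann_mapping_theorem[of S] assms(1,2) by metis
  then show ?thesis
  proof cases
    \<comment> \<open>The whole plane is not biholomorphic to the disc, but it is itself
      convex.\<close>
    case 2
    then show ?thesis
      using convex_curl_free_imp_gradient[OF _ _ _ deriv cont sym] by simp
  next
    case disc
    \<comment> \<open>The gradient field is pulled back to the disc along the holomorphic \<open>g\<close>; there
      \<open>D\<^sup>2g h k = g'' h k\<close> is symmetric, so the pulled back field \<open>d\<close> is again curl-free.\<close>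
    let ?B = "ball 0 1 :: complex set"
    have g': "(g has_field_derivative deriv g z) (at z)"
      and g'': "(deriv g has_field_derivative deriv (deriv g) z) (at z)" if "z \<in> ?B" for z
      using that disc(2) holomorphic_deriv[OF disc(2)] by (auto intro: holomorphic_derivI)
    define d where "d z = cnj (deriv g z) * c (g z)" for z
    define d' where
      "d' z h = cnj (deriv (deriv g) z * h) * c (g z) + cnj (deriv g z) * c' (g z) (deriv g z * h)" for z h
    \<comment> \<open>Multiplication by \<open>cnj w\<close> is adjoint to multiplication by
      \<open>w\<close>; this explains the factor \<open>cnj (deriv g z)\<close> in
      \<open>d\<close>.\<close>
    have inner_cnj: "(cnj w * u) \<bullet> v = u \<bullet> (w * v)" for u v w :: complex
      by (simp add: inner_complex_def algebra_simps)
    have "\<exists>f. \<forall>z\<in>?B. (f has_derivative (\<lambda>h. d z \<bullet> h)) (at z)"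
    proof (rule convex_curl_free_imp_gradient[where c' = d'])
      fix z assume z: "z \<in> ?B"
      have "((\<lambda>z. c (g z)) has_derivative (\<lambda>h. c' (g z) (deriv g z * h))) (at z)"
        by (rule has_derivative_compose[OF _ deriv])
          (use g'[OF z] disc(4)[OF z] in \<open>auto simp: has_field_derivative_def\<close>)
      moreover have "((\<lambda>z. cnj (deriv g z)) has_derivative (\<lambda>h. cnj (deriv (deriv g) z * h))) (at z)"
        using g''[OF z] by (intro has_derivative_cnj) (simp add: has_field_derivative_def)
      ultimately show "(d has_derivative d' z) (at z)"
        unfolding d_def d'_def by (subst add.commute) (rule has_derivative_mult[rotated])
    next
      fix h
      have cont_g: "continuous_on ?B g" "continuous_on ?B (deriv g)" "continuous_on ?B (deriv (deriv g))"
        using disc(2) holomorphic_deriv[OF disc(2)] holomorphic_deriv[OF holomorphic_deriv[OF disc(2)]]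
        by (auto intro: holomorphic_on_imp_continuous_on)
      have cont_c: "continuous_on S c"
        using deriv has_derivative_continuous continuous_at_imp_continuous_on by blast
      \<comment> \<open>Continuity of \<open>c'\<close> is given for fixed directions only, whereas
        \<open>deriv g z * h\<close> moves with \<open>z\<close>; expanding in the real basis
        \<open>1\<close>, \<open>\<i>\<close> separates the two dependences.\<close>
      have split: "c' (g z) k = Re k *\<^sub>R c' (g z) 1 + Im k *\<^sub>R c' (g z) \<i>" if "z \<in> ?B" for z k
      proof -
        have lin: "linear (c' (g z))"
          using deriv has_derivative_linear disc(4)[OF that] by blast
        have "k = Re k *\<^sub>R 1 + Im k *\<^sub>R \<i>"
          by (simp add: complex_eq_iff)
        then show ?thesis
          using linear_add[OF lin] linear_scale[OF lin] by metis
      qed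
      have "continuous_on ?B (\<lambda>z. c' (g z) k)" for k
        using disc(4) by (intro continuous_on_compose2[OF cont cont_g(1)]) auto
      then have "continuous_on ?B (\<lambda>z. Re (deriv g z * h) *\<^sub>R c' (g z) 1 + Im (deriv g z * h) *\<^sub>R c' (g z) \<i>)"
        by (intro continuous_intros cont_g)
      then have "continuous_on ?B (\<lambda>z. c' (g z) (deriv g z * h))"
        by (rule continuous_on_eq) (rule split[symmetric])
      moreover have "continuous_on ?B (\<lambda>z. c (g z))"
        using disc(4) by (intro continuous_on_compose2[OF cont_c cont_g(1)]) auto
      ultimately show "continuous_on ?B (\<lambda>z. d' z h)"
        unfolding d'_def by (intro continuous_intros cont_g)
    next
      fix z h k assume "z \<in> ?B"
      then have "c' (g z) (deriv g z * h) \<bullet> (deriv g z * k) = c' (g z) (deriv g z * k) \<bullet> (deriv g z * h)"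
        using sym disc(4) by blast
      then show "d' z h \<bullet> k = d' z k \<bullet> h"
        unfolding d'_def by (simp only: inner_add_left inner_cnj) (simp add: ac_simps)
    qed auto
    then obtain f where f: "\<And>z. z \<in> ?B \<Longrightarrow> (f has_derivative (\<lambda>h. d z \<bullet> h)) (at z)"
      by blast
    have "((\<lambda>z. f (r z)) has_derivative (\<lambda>h. c z \<bullet> h)) (at z)" if z: "z \<in> S" for z
    proof -
      have r': "(r has_field_derivative deriv r z) (at z)"
        using disc(1) assms(1) z holomorphic_derivI by blast
      have "((\<lambda>x. g (r x)) has_field_derivative deriv g (r z) * deriv r z) (at z)"
        using r' g' disc(3)[OF z] DERIV_chain2 by blast
      moreover have "((\<lambda>x. g (r x)) has_field_derivative 1) (at z)"
        using disc(3) by (intro has_field_derivative_transform_within_open[OF DERIV_ident assms(1) z]) auto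
      \<comment> \<open>This cancels the factor that the pullback along \<open>g\<close> introduced,
        so \<open>f \<circ> r\<close> has gradient \<open>c\<close>.\<close>
      ultimately have "deriv g (r z) * deriv r z = 1"
        using DERIV_unique by blast
      then have "d (r z) \<bullet> (deriv r z * h) = c z \<bullet> h" for h
        unfolding d_def inner_cnj using disc(3)[OF z] by (simp flip: mult.assoc)
      moreover have "((\<lambda>z. f (r z)) has_derivative (\<lambda>h. d (r z) \<bullet> (deriv r z * h))) (at z)"
        by (rule has_derivative_compose[OF _ f]) (use r' disc(3)[OF z] in \<open>auto simp: has_field_derivative_def\<close>)
      ultimately show ?thesis
        by simp
    qed
    then show ?thesis
      by blast
  qed simp
qed

text \<open>The plane is identified with the complex numbers by the linear maps \<open>P\<close> and
  \<open>Q\<close>. Closedness of the form is then symmetry of the Jacobian of the field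
  \<open>(a, b)\<close>.\<close>

lemma closed_form_exact:
  fixes a b :: "real \<times> real \<Rightarrow> real"
  assumes "open M" "simply_connected M" "smooth M a" "smooth M b"
    and closed: "\<And>q. q \<in> M \<Longrightarrow> pd_v a q = pd_u b q"
  shows "\<exists>f. is_line_integral M a b f"
proof -
  define P where "P z = (Re z, Im z)" for z
  define Q where "Q q = Complex (fst q) (snd q)" for q
  have PQ [simp]: "P (Q q) = q" "Q (P z) = z" for q z
    by (simp_all add: P_def Q_def)
  have cont_P: "continuous_on A P" for A
    unfolding P_def by (intro continuous_intros)
  have Q_eq: "Q q = fst q *\<^sub>R 1 + snd q *\<^sub>R \<i>" for q
    by (simp add: Q_def complex_eq_iff)
  have Q_deriv: "(Q has_derivative Q) (at q)" for q
    unfolding Q_eq[abs_def] by (auto intro!: derivative_eq_intros)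
  have P_deriv: "(P has_derivative P) (at z)" for z
    unfolding P_def[abs_def] by (auto intro!: derivative_eq_intros)
  let ?S = "P -` M"
  have "continuous_on M Q"
    using Q_deriv has_derivative_continuous continuous_at_imp_continuous_on by blast
  then have "homeomorphism M ?S Q P"
    by (intro homeomorphismI cont_P) auto
  then have sc: "simply_connected ?S"
    using assms(2) homeomorphic_simply_connected homeomorphic_def by blast
  have "open ?S"
    using open_vimage[OF assms(1) cont_P] .
  define c where "c z = Complex (a (P z)) (b (P z))" for z
  define c' where "c' z h = Complex (Re h * pd_u a (P z) + Im h * pd_v a (P z))
    (Re h * pd_u b (P z) + Im h * pd_v b (P z))" for z h
  have "\<exists>f. \<forall>z\<in>?S. (f has_derivative (\<lambda>h. c z \<bullet> h)) (at z)"
  proof (rule simply_connected_curl_free_imp_gradient[OF \<open>open ?S\<close> sc, where c' = c'])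
    fix z assume "z \<in> ?S"
    then have "P z \<in> M"
      by simp
    note ab = smooth_derivative[OF assms(3) this] smooth_derivative[OF assms(4) this]
    have "((\<lambda>z. (a (P z), b (P z))) has_derivative
        (\<lambda>h. (fst (P h) *\<^sub>R pd_u a (P z) + snd (P h) *\<^sub>R pd_v a (P z),
          fst (P h) *\<^sub>R pd_u b (P z) + snd (P h) *\<^sub>R pd_v b (P z)))) (at z)"
      by (rule has_derivative_Pair[OF has_derivative_compose[OF P_deriv ab(1)]
            has_derivative_compose[OF P_deriv ab(2)]])
    from has_derivative_compose[OF this Q_deriv]
    show "(c has_derivative c' z) (at z)"
      by (simp add: c_def[abs_def] c'_def[abs_def] Q_def P_def)
  next
    fix h
    have "C_class 0 M (pd_u a)" "C_class 0 M (pd_v a)" "C_class 0 M (pd_u b)" "C_class 0 M (pd_v b)"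
      using assms(3,4) unfolding smooth_def by (metis C_class.simps(2))+
    then have "continuous_on ?S (\<lambda>z. pd_u a (P z))" "continuous_on ?S (\<lambda>z. pd_v a (P z))"
      "continuous_on ?S (\<lambda>z. pd_u b (P z))" "continuous_on ?S (\<lambda>z. pd_v b (P z))"
      by (auto intro!: continuous_on_compose2[OF _ cont_P, of M])
    then show "continuous_on ?S (\<lambda>z. c' z h)"
      unfolding c'_def by (intro continuous_intros)
  next
    fix z h k assume "z \<in> ?S"
    then show "c' z h \<bullet> k = c' z k \<bullet> h"
      using closed by (simp add: c'_def inner_complex_def algebra_simps)
  qed
  then obtain f where f: "\<And>z. z \<in> ?S \<Longrightarrow> (f has_derivative (\<lambda>h. c z \<bullet> h)) (at z)"
    by blast
  have "((\<lambda>q. f (Q q)) has_derivative (\<lambda>h. a q * fst h + b q * snd h)) (at q)" if "q \<in> M" for q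
    using has_derivative_compose[OF Q_deriv f[of "Q q"]] that
    by (simp add: c_def inner_complex_def) (simp add: Q_def)
  then show ?thesis
    using is_line_integralI by blast
qed

subsection \<open>Null immersions into Minkowski space\<close>

lemma mat2_mult:
  "mat2 a b c d ** mat2 a' b' c' d' =
    mat2 (a * a' + b * c') (a * b' + b * d') (c * a' + d * c') (c * b' + d * d')"
  by (simp add: mat2_def matrix_matrix_mult_def vec_eq_iff forall_2 sum_2)

lemma det_mat2: "det (mat2 a b c d) = a * d - b * c"
  by (simp add: mat2_def det_2)

lemma matrix_inv_mat2:
  assumes "a * d - b * c = 1"
  shows "matrix_inv (mat2 a b c d) = mat2 d (- b) (- c) a"
proof -
  have one: "mat 1 = mat2 1 0 0 1"
    by (simp add: mat2_def mat_def vec_eq_iff forall_2)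
  have r: "mat2 a b c d ** mat2 d (- b) (- c) a = mat 1"
    and l: "mat2 d (- b) (- c) a ** mat2 a b c d = mat 1"
    using assms by (simp_all add: mat2_mult one algebra_simps)
  \<comment> \<open>\<open>matrix_inv\<close> is given by a choice, so the adjugate is identified
    with it through uniqueness of the inverse.\<close>
  have "B = mat2 d (- b) (- c) a" if "mat2 a b c d ** B = mat 1" for B
    using that l by (metis matrix_mul_assoc matrix_mul_lid matrix_mul_rid)
  with r l show ?thesis
    unfolding matrix_inv_def by (intro some_equality) blast+
qed

lemma mink_scaleR: "mink (a *\<^sub>R x) y = a * mink x y" "mink x (a *\<^sub>R y) = a * mink x y"
  by (simp_all add: mink_def algebra_simps)

lemma mink_combination:
  "mink (a *\<^sub>R x + b *\<^sub>R y) (c *\<^sub>R x + d *\<^sub>R y) =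
    a * c * mink x x + (a * d + b * c) * mink x y + b * d * mink y y"
  by (simp add: mink_def algebra_simps)

text \<open>Everything follows from the Gram matrix of the two null partials: the induced metric is
  \<open>\<rho>\<close> times the polarisation of \<open>du_dv\<close>.\<close>

lemma null_immersion_timelike:
  assumes "smooth M \<phi>"
    and "\<And>q. q \<in> M \<Longrightarrow> mink (pd_u \<phi> q) (pd_u \<phi> q) = 0"
    and "\<And>q. q \<in> M \<Longrightarrow> mink (pd_v \<phi> q) (pd_v \<phi> q) = 0"
    and "\<And>q. q \<in> M \<Longrightarrow> mink (pd_u \<phi> q) (pd_v \<phi> q) = \<rho> q / 2"
    and "\<And>q. q \<in> M \<Longrightarrow> \<rho> q > 0"
  shows "timelike_immersion M \<phi>" and "has_metric M \<phi> \<rho>"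
proof -
  have deriv: "frechet_derivative \<phi> (at q) = (\<lambda>h. fst h *\<^sub>R pd_u \<phi> q + snd h *\<^sub>R pd_v \<phi> q)"
    if "q \<in> M" for q
    using frechet_derivative_at[OF smooth_derivative[OF assms(1) that]] by simp
  have metric: "induced_metric \<phi> q X Y = \<rho> q / 2 * (fst X * snd Y + snd X * fst Y)"
    if "q \<in> M" for q X Y
    by (simp add: induced_metric_def deriv[OF that] mink_combination assms(2-4)[OF that])
  show "has_metric M \<phi> \<rho>"
    by (simp add: has_metric_def metric du_dv_def)
  show "timelike_immersion M \<phi>"
    unfolding timelike_immersion_def
  proof (intro conjI ballI)
    fix q assume q: "q \<in> M"
    let ?D = "frechet_derivative \<phi> (at q)"
    have lin: "linear ?D"
      using smooth_derivative[OF assms(1) q] has_derivative_linear deriv[OF q] by metis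
    \<comment> \<open>A kernel vector is orthogonal to all vectors; testing against the two null
      directions kills its coordinates.\<close>
    show "inj ?D"
    proof (subst linear_injective_0[OF lin], intro allI impI)
      fix X assume "?D X = 0"
      then have "induced_metric \<phi> q X Y = 0" for Y
        by (simp add: induced_metric_def mink_def)
      from this[of "(1, 0)"] this[of "(0, 1)"] show "X = 0"
        using metric[OF q] assms(5)[OF q] by (simp add: prod_eq_iff)
    qed
    \<comment> \<open>\<open>r\<close> normalises the vectors \<open>(1, -1)\<close> and
      \<open>(1, 1)\<close>, whose squares are \<open>- \<rho> q\<close> and
      \<open>\<rho> q\<close>.\<close>
    define r where "r = 1 / sqrt (\<rho> q)"
    have r: "\<rho> q * (r * r) = 1"
      using assms(5)[OF q] by (simp add: r_def)
    show "lorentzian (induced_metric \<phi> q)"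
      unfolding lorentzian_def
    proof (intro conjI allI exI)
      show "bilinear (induced_metric \<phi> q)"
        unfolding bilinear_def metric[OF q, abs_def]
        by (auto intro!: linearI simp: field_simps)
      show "induced_metric \<phi> q X Y = induced_metric \<phi> q Y X" for X Y
        by (simp add: metric[OF q] algebra_simps)
      show "induced_metric \<phi> q (r, - r) (r, - r) = - 1" "induced_metric \<phi> q (r, r) (r, r) = 1"
        "induced_metric \<phi> q (r, - r) (r, r) = 0"
        using r by (simp_all add: metric[OF q])
    qed
  qed (rule assms(1))
qed

subsection \<open>Surfaces from pairs of spinors\<close>

text \<open>The last assumption is invertibility of the spinor matrix, whose determinant is
  \<open>s1 q * s2 q + t1 q * t2 q\<close>; its sign is left open.\<close>

locale spinor_pair =
  fixes M :: "(real \<times> real) set" and p s1 s2 t1 t2 :: "real \<times> real \<Rightarrow> real"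
  assumes open_M: "open M"
    and smooth: "smooth M s1" "smooth M s2" "smooth M t1" "smooth M t2"
    and dirac: "\<And>q. q \<in> M \<Longrightarrow> pd_v s1 q = p q * t2 q" "\<And>q. q \<in> M \<Longrightarrow> pd_u t2 q = - (p q * s1 q)"
      "\<And>q. q \<in> M \<Longrightarrow> pd_u s2 q = p q * t1 q" "\<And>q. q \<in> M \<Longrightarrow> pd_v t1 q = - (p q * s2 q)"
    and nondegenerate: "\<And>q. q \<in> M \<Longrightarrow> s1 q * s2 q + t1 q * t2 q \<noteq> 0"
begin

lemmas smooth_rules = smooth_const[OF open_M] smooth_add[OF open_M] smooth_minus[OF open_M]
  smooth_diff[OF open_M] smooth_mult[OF open_M] smooth_scaleR[OF open_M] smooth_power2[OF open_M]
  smooth_exp[OF open_M] smooth_vector3[OF open_M] smooth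

lemma differentiable [simp]:
  assumes "q \<in> M"
  shows "s1 differentiable (at q)" "s2 differentiable (at q)" "t1 differentiable (at q)" "t2 differentiable (at q)"
  using smooth smooth_imp_differentiable assms by blast+

text \<open>With \<open>A\<close> the spinor matrix and \<open>adj A\<close> its adjugate,
  \<open>quat\<close> sends this vector to \<open>A E12 adj A\<close>; \<open>tangent_v\<close> and
  \<open>normal_dir\<close> likewise go to \<open>A E21 adj A\<close> and
  \<open>A quat_k adj A\<close>, where \<open>E12\<close>, \<open>E21\<close> are elementary
  matrices.\<close>

definition tangent_u :: "real \<times> real \<Rightarrow> real ^ 3" where
  "tangent_u q = vector [1/2 * ((s1 q)\<^sup>2 + (t1 q)\<^sup>2), 1/2 * ((s1 q)\<^sup>2 - (t1 q)\<^sup>2), - (s1 q * t1 q)]"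

definition tangent_v :: "real \<times> real \<Rightarrow> real ^ 3" where
  "tangent_v q = vector [- (1/2) * ((s2 q)\<^sup>2 + (t2 q)\<^sup>2), 1/2 * ((s2 q)\<^sup>2 - (t2 q)\<^sup>2), - (s2 q * t2 q)]"

definition normal_dir :: "real \<times> real \<Rightarrow> real ^ 3" where
  "normal_dir q = vector [s1 q * t2 q - t1 q * s2 q, s1 q * t2 q + t1 q * s2 q, s1 q * s2 q - t1 q * t2 q]"

text \<open>The square makes the logarithm meaningful for either sign of the determinant.\<close>

definition \<omega> :: "real \<times> real \<Rightarrow> real" where
  "\<omega> q = ln ((s1 q * s2 q + t1 q * t2 q)\<^sup>2)"

text \<open>Here \<open>e\<^bsup>-\<omega>/2\<^esup> = 1 / \<bar>s\<^sub>1 s\<^sub>2 + t\<^sub>1 t\<^sub>2\<bar>\<close>, so where the determinant of the spinor matrix \<open>\<Phi>\<close> is negative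
  this normal is \<open>- \<Phi> k' \<Phi>\<^sup>-\<^sup>1\<close>; that sign keeps \<open>H = 2 p e\<^bsup>-\<omega>/2\<^esup>\<close> valid there.\<close>

definition N :: "real \<times> real \<Rightarrow> real ^ 3" where
  "N q = exp (- \<omega> q / 2) *\<^sub>R normal_dir q"

lemma smooth_tangent: "smooth M tangent_u" "smooth M tangent_v"
  unfolding tangent_u_def[abs_def] tangent_v_def[abs_def] by (intro smooth_rules)+

lemma smooth_\<omega>: "smooth M \<omega>"
  unfolding \<omega>_def[abs_def] using nondegenerate by (intro smooth_ln[OF open_M] smooth_rules) simp

lemma smooth_scaled_\<omega>: "smooth M (\<lambda>q. exp (- \<omega> q / c))"
  unfolding divide_inverse by (intro smooth_rules smooth_\<omega>)

lemma smooth_N: "smooth M N"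
  unfolding N_def[abs_def] normal_dir_def[abs_def] by (intro smooth_rules smooth_scaled_\<omega>)

lemma exp_\<omega>: "q \<in> M \<Longrightarrow> exp (\<omega> q) = (s1 q * s2 q + t1 q * t2 q)\<^sup>2"
  unfolding \<omega>_def using nondegenerate by simp

text \<open>Only \<open>s1\<close> and \<open>t1\<close> enter \<open>tangent_u\<close>, and the
  Dirac equations prescribe exactly their v-derivatives. The u-derivatives of \<open>s2\<close> and
  \<open>t2\<close> give the same vector for \<open>tangent_v\<close>, so the three forms are
  closed.\<close>

lemma pd_v_tangent_u:
  assumes "q \<in> M"
  shows "pd_v tangent_u q = p q *\<^sub>R normal_dir q"
proof -
  have "tangent_u differentiable (at q)"
    using smooth_tangent(1) assms smooth_imp_differentiable by blast
  note pd_v_nth[OF this, symmetric]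
  then show ?thesis
    using assms
    by (simp add: vec_eq_iff forall_3 tangent_u_def[abs_def] normal_dir_def power2_eq_square
        partial_rules partial_minus partial_divide dirac algebra_simps)
qed

lemma pd_u_tangent_v:
  assumes "q \<in> M"
  shows "pd_u tangent_v q = p q *\<^sub>R normal_dir q"
proof -
  have "tangent_v differentiable (at q)"
    using smooth_tangent(2) assms smooth_imp_differentiable by blast
  note pd_u_nth[OF this, symmetric]
  then show ?thesis
    using assms
    by (simp add: vec_eq_iff forall_3 tangent_v_def[abs_def] normal_dir_def power2_eq_square
        partial_rules partial_minus partial_divide dirac algebra_simps)
qed

lemma spinor_surface_iff:
  "spinor_surface M s1 s2 t1 t2 \<phi> \<longleftrightarrow>
    (\<forall>i. is_line_integral M (\<lambda>q. tangent_u q $ i) (\<lambda>q. tangent_v q $ i) (\<lambda>q. \<phi> q $ i))"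
  by (simp add: spinor_surface_def tangent_u_def tangent_v_def forall_3)

lemma spinor_surface_exists:
  assumes "simply_connected M"
  shows "\<exists>\<phi>. spinor_surface M s1 s2 t1 t2 \<phi>"
proof -
  have "\<exists>f. is_line_integral M (\<lambda>q. tangent_u q $ i) (\<lambda>q. tangent_v q $ i) f" for i
  proof (rule closed_form_exact[OF open_M assms])
    show "smooth M (\<lambda>q. tangent_u q $ i)" "smooth M (\<lambda>q. tangent_v q $ i)"
      using smooth_component[OF open_M] smooth_tangent by blast+
    fix q assume q: "q \<in> M"
    then have "tangent_u differentiable (at q)" "tangent_v differentiable (at q)"
      using smooth_tangent smooth_imp_differentiable by blast+
    then show "pd_v (\<lambda>q. tangent_u q $ i) q = pd_u (\<lambda>q. tangent_v q $ i) q"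
      by (simp add: pd_v_nth pd_u_nth pd_v_tangent_u[OF q] pd_u_tangent_v[OF q])
  qed
  then obtain F where "\<And>i. is_line_integral M (\<lambda>q. tangent_u q $ i) (\<lambda>q. tangent_v q $ i) (F i)"
    by metis
  then have "spinor_surface M s1 s2 t1 t2 (\<lambda>q. \<chi> i. F i q)"
    by (simp add: spinor_surface_iff)
  then show ?thesis
    by blast
qed

text \<open>Since \<open>mink x x = - det (quat x)\<close>, the two squares vanish because
  elementary matrices are singular; for \<open>normal_dir\<close> the same rule gives the square of
  the determinant, \<open>quat_k\<close> having determinant -1.\<close>

lemma mink_tangents:
  "mink (tangent_u q) (tangent_u q) = 0" "mink (tangent_v q) (tangent_v q) = 0"
  "mink (tangent_u q) (tangent_v q) = (s1 q * s2 q + t1 q * t2 q)\<^sup>2 / 2"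
  by (simp_all add: mink_def tangent_u_def tangent_v_def power2_eq_square field_simps)

lemma mink_normal_dir:
  "mink (normal_dir q) (normal_dir q) = (s1 q * s2 q + t1 q * t2 q)\<^sup>2"
  "mink (normal_dir q) (tangent_u q) = 0" "mink (normal_dir q) (tangent_v q) = 0"
  by (simp_all add: mink_def normal_dir_def tangent_u_def tangent_v_def power2_eq_square field_simps)

section \<open>Geometry of a given surface with these line integrals\<close>

context
  fixes \<phi> :: "real \<times> real \<Rightarrow> real ^ 3"
  assumes surface: "spinor_surface M s1 s2 t1 t2 \<phi>"
begin

lemma surface_derivative:
  assumes "q \<in> M"
  shows "(\<phi> has_derivative (\<lambda>h. fst h *\<^sub>R tangent_u q + snd h *\<^sub>R tangent_v q)) (at q)"
proof (rule has_derivative_vec)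
  fix i
  have "continuous_on M (\<lambda>q. tangent_u q $ i)" "continuous_on M (\<lambda>q. tangent_v q $ i)"
    by (intro smooth_imp_continuous_on smooth_component[OF open_M] smooth_tangent)+
  from is_line_integral_imp_derivative[OF open_M this _ assms]
  show "((\<lambda>q. \<phi> q $ i) has_derivative (\<lambda>h. (fst h *\<^sub>R tangent_u q + snd h *\<^sub>R tangent_v q) $ i)) (at q)"
    using surface unfolding spinor_surface_iff by (simp add: mult.commute)
qed

lemma surface_partials:
  assumes "q \<in> M"
  shows "pd_u \<phi> q = tangent_u q" "pd_v \<phi> q = tangent_v q"
  using partial_eq_derivative[OF surface_derivative[OF assms]] by simp_all

lemma smooth_surface: "smooth M \<phi>"
  using smoothI[OF open_M surface_derivative] smooth_tangent by simp

lemma surface_geometry: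
  shows "timelike_immersion M \<phi>" "null_conformal M \<phi> \<omega>" "unit_normal M \<phi> N"
    and "has_metric M \<phi> (\<lambda>q. (s1 q * s2 q + t1 q * t2 q)\<^sup>2)"
proof -
  show "timelike_immersion M \<phi>" "has_metric M \<phi> (\<lambda>q. (s1 q * s2 q + t1 q * t2 q)\<^sup>2)"
    using null_immersion_timelike[OF smooth_surface, of "\<lambda>q. (s1 q * s2 q + t1 q * t2 q)\<^sup>2"] nondegenerate
    by (simp_all add: surface_partials mink_tangents)
  show "null_conformal M \<phi> \<omega>"
    by (simp add: null_conformal_def smooth_\<omega> surface_partials mink_tangents exp_\<omega>)
  show "unit_normal M \<phi> N"
    by (simp add: unit_normal_def smooth_N surface_partials N_def mink_scaleR mink_normal_dir
        flip: exp_\<omega> exp_add)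
qed

lemma surface_mean_curvature:
  assumes "q \<in> M"
  shows "mean_curvature \<phi> \<omega> N q = 2 * p q * exp (- \<omega> q / 2)"
proof -
  have "pd_v (pd_u \<phi>) q = pd_v tangent_u q"
    using smooth_tangent(1) assms
    by (intro pd_v_cong[OF open_M assms, symmetric]) (auto simp: surface_partials smooth_imp_differentiable)
  \<comment> \<open>The square of \<open>normal_dir\<close> is \<open>exp (\<omega> q)\<close> and
    cancels the conformal factor of the mean curvature; the scaling of \<open>N\<close>
    remains.\<close>
  then have "mean_curvature \<phi> \<omega> N q = 2 * p q * exp (- \<omega> q / 2) * (exp (- \<omega> q) * exp (\<omega> q))"
    by (simp add: mean_curvature_def pd_v_tangent_u[OF assms] N_def mink_scaleR mink_normal_dir exp_\<omega>[OF assms])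
  moreover have "exp (- \<omega> q) * exp (\<omega> q) = 1"
    by (simp flip: exp_add)
  ultimately show ?thesis
    by simp
qed

text \<open>Positivity makes the determinant equal to \<open>exp (\<omega> q / 2)\<close> rather
  than its negative, so a positive rescaling of the spinor matrix lands in SL(2,R).\<close>

lemma surface_conformal_frame:
  assumes pos: "\<And>q. q \<in> M \<Longrightarrow> s1 q * s2 q + t1 q * t2 q > 0"
  shows "conformal_frame M \<phi> \<omega> N (spinor_matrix s1 s2 t1 t2)"
proof -
  \<comment> \<open>The determinant is quadratic in the entries, so this factor contributes
    \<open>exp (- \<omega> q / 2)\<close>.\<close>
  define r where "r q = exp (- \<omega> q / 4)" for q
  define \<Phi> where "\<Phi> q = mat2 (r q * s1 q) (- (r q * t2 q)) (r q * t1 q) (r q * s2 q)" for q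
  have smooth_\<Phi>: "smooth M \<Phi>"
    unfolding \<Phi>_def[abs_def] r_def
    by (intro smooth_mat2[OF open_M] smooth_rules smooth_scaled_\<omega>)
  have "spinor_matrix s1 s2 t1 t2 q = exp (\<omega> q / 4) *\<^sub>R \<Phi> q" for q
    by (simp add: spinor_matrix_def \<Phi>_def r_def mat2_def vec_eq_iff forall_2 exp_minus)
  moreover have "coordinate_frame M \<phi> \<omega> N \<Phi>"
    unfolding coordinate_frame_def
  proof (intro conjI ballI surface_geometry smooth_\<Phi>)
    fix q assume q: "q \<in> M"
    have r: "exp (- \<omega> q / 2) = r q * r q"
      by (simp add: r_def flip: exp_add)
    have "(exp (\<omega> q / 2))\<^sup>2 = exp (\<omega> q)"
      by (simp add: power2_eq_square flip: exp_add)
    also note exp_\<omega>[OF q]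
    finally have "exp (\<omega> q / 2) = s1 q * s2 q + t1 q * t2 q"
      by (rule power2_eq_imp_eq) (use pos[OF q] in simp_all)
    moreover have "exp (- \<omega> q / 2) * exp (\<omega> q / 2) = 1"
      by (simp flip: exp_add)
    ultimately have unit: "(r q * s1 q) * (r q * s2 q) - - (r q * t2 q) * (r q * t1 q) = 1"
      unfolding r by (simp add: algebra_simps)
    then show "det (\<Phi> q) = 1"
      by (simp add: \<Phi>_def det_mat2)
    \<comment> \<open>With determinant 1 the inverse is the adjugate, and the frame equations become
      polynomial identities in the entries.\<close>
    note simps = \<Phi>_def matrix_inv_mat2[OF unit] quat_i_def quat_j_def quat_k_def mat2_mult quat_eq_mat2
      surface_partials[OF q] tangent_u_def tangent_v_def N_def normal_dir_def r
    show "\<Phi> q ** quat_i ** matrix_inv (\<Phi> q) = quat (exp (- \<omega> q / 2) *\<^sub>R (pd_u \<phi> q - pd_v \<phi> q))"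
      "\<Phi> q ** quat_j ** matrix_inv (\<Phi> q) = quat (exp (- \<omega> q / 2) *\<^sub>R (pd_u \<phi> q + pd_v \<phi> q))"
      "\<Phi> q ** quat_k ** matrix_inv (\<Phi> q) = quat (N q)"
      unfolding simps by (simp_all add: mat2_def vec_eq_iff forall_2 power2_eq_square field_simps)
  qed
  ultimately show ?thesis
    unfolding conformal_frame_def by blast
qed

end

end

text \<open>Simple connectivity supplies the integrals; the geometry holds for every surface they
  define. A conformal frame has determinant \<open>exp (\<omega> q / 2) > 0\<close>, which is why
  the frame claim asks for a positive determinant; one point suffices on a connected
  \<open>M\<close>.\<close>

theorem theorem2:
  fixes M :: "(real \<times> real) set" and p s1 s2 t1 t2 :: "real \<times> real \<Rightarrow> real"
  assumes "open M" and "connected M"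
    and "smooth M p"
    and "dirac_solution M p (\<lambda>q. vector [s1 q, - t2 q])"
    and "dirac_solution M p (\<lambda>q. vector [t1 q, s2 q])"
    and "\<forall>q\<in>M. invertible (spinor_matrix s1 s2 t1 t2 q)"
  shows "(simply_connected M \<longrightarrow> (\<exists>\<phi>. spinor_surface M s1 s2 t1 t2 \<phi>)) \<and>
    (\<forall>\<phi>. spinor_surface M s1 s2 t1 t2 \<phi> \<longrightarrow>
      (\<exists>\<omega> N. timelike_immersion M \<phi> \<and> null_conformal M \<phi> \<omega> \<and> unit_normal M \<phi> N \<and>
        has_metric M \<phi> (\<lambda>q. exp (\<omega> q)) \<and>
        has_metric M \<phi> (\<lambda>q. (s1 q * s2 q + t1 q * t2 q)\<^sup>2) \<and>
        (\<forall>q\<in>M. mean_curvature \<phi> \<omega> N q = 2 * p q * exp (- \<omega> q / 2)) \<and>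
        ((\<exists>q\<in>M. det (spinor_matrix s1 s2 t1 t2 q) > 0) \<longrightarrow>
           conformal_frame M \<phi> \<omega> N (spinor_matrix s1 s2 t1 t2))))"
proof -
  have det: "det (spinor_matrix s1 s2 t1 t2 q) = s1 q * s2 q + t1 q * t2 q" for q
    by (simp add: spinor_matrix_def det_mat2 algebra_simps)
  have smooth: "smooth M s1" "smooth M (\<lambda>q. - t2 q)" "smooth M t1" "smooth M s2"
    using assms(4,5) smooth_component[OF assms(1), of "\<lambda>q. vector [s1 q, - t2 q] :: real ^ 2" 1]
      smooth_component[OF assms(1), of "\<lambda>q. vector [s1 q, - t2 q] :: real ^ 2" 2]
      smooth_component[OF assms(1), of "\<lambda>q. vector [t1 q, s2 q] :: real ^ 2" 1]
      smooth_component[OF assms(1), of "\<lambda>q. vector [t1 q, s2 q] :: real ^ 2" 2]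
    by (simp_all add: dirac_solution_def)
  from smooth_minus[OF assms(1) this(2)] have smooth_t2: "smooth M t2"
    by simp
  interpret spinor_pair M p s1 s2 t1 t2
  proof
    fix q assume q: "q \<in> M"
    have "dirac_op (\<lambda>q. vector [s1 q, - t2 q]) q = p q *\<^sub>R vector [s1 q, - t2 q]"
      "dirac_op (\<lambda>q. vector [t1 q, s2 q]) q = p q *\<^sub>R vector [t1 q, s2 q]"
      using assms(4,5) q by (simp_all add: dirac_solution_def)
    then show "pd_v s1 q = p q * t2 q" "pd_u t2 q = - (p q * s1 q)"
      "pd_u s2 q = p q * t1 q" "pd_v t1 q = - (p q * s2 q)"
      using pd_u_minus[OF smooth_imp_differentiable[OF smooth_t2 q]]
      by (simp_all add: dirac_op_def vec_eq_iff forall_2)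
    show "s1 q * s2 q + t1 q * t2 q \<noteq> 0"
      using assms(6) q by (simp add: invertible_det_nz det)
  qed (use assms(1) smooth smooth_t2 in auto)
  have pos: "s1 q * s2 q + t1 q * t2 q > 0"
    if x: "x \<in> M" "s1 x * s2 x + t1 x * t2 x > 0" and q: "q \<in> M" for x q
  proof (rule ccontr)
    let ?D = "\<lambda>q. s1 q * s2 q + t1 q * t2 q"
    assume "\<not> ?D q > 0"
    have "continuous_on M ?D"
      by (intro smooth_imp_continuous_on smooth_rules)
    then have "connected (?D ` M)"
      using assms(2) connected_continuous_image by blast
    \<comment> \<open>Intermediate values: a determinant positive at \<open>x\<close> and not
      positive at \<open>q\<close> would vanish somewhere on \<open>M\<close>.\<close>
    then have "{?D q..?D x} \<subseteq> ?D ` M"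
      using x q by (intro connected_contains_Icc) auto
    then have "0 \<in> ?D ` M"
      using x(2) \<open>\<not> ?D q > 0\<close> by (meson atLeastAtMost_iff less_imp_le not_le subsetD)
    then show False
      using nondegenerate by force
  qed
  show ?thesis
  proof (intro conjI allI impI)
    show "\<exists>\<phi>. spinor_surface M s1 s2 t1 t2 \<phi>" if "simply_connected M"
      using that by (rule spinor_surface_exists)
  next
    fix \<phi> assume surface: "spinor_surface M s1 s2 t1 t2 \<phi>"
    note geometry = surface_geometry[OF surface]
    show "\<exists>\<omega> N. timelike_immersion M \<phi> \<and> null_conformal M \<phi> \<omega> \<and> unit_normal M \<phi> N \<and>
        has_metric M \<phi> (\<lambda>q. exp (\<omega> q)) \<and>
        has_metric M \<phi> (\<lambda>q. (s1 q * s2 q + t1 q * t2 q)\<^sup>2) \<and>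
        (\<forall>q\<in>M. mean_curvature \<phi> \<omega> N q = 2 * p q * exp (- \<omega> q / 2)) \<and>
        ((\<exists>q\<in>M. det (spinor_matrix s1 s2 t1 t2 q) > 0) \<longrightarrow>
           conformal_frame M \<phi> \<omega> N (spinor_matrix s1 s2 t1 t2))"
    proof (intro exI[of _ \<omega>] exI[of _ N] conjI geometry ballI impI)
      show "has_metric M \<phi> (\<lambda>q. exp (\<omega> q))"
        using geometry(4) by (simp add: has_metric_def exp_\<omega>)
      show "mean_curvature \<phi> \<omega> N q = 2 * p q * exp (- \<omega> q / 2)" if "q \<in> M" for q
        using surface_mean_curvature[OF surface that] .
      assume "\<exists>q\<in>M. det (spinor_matrix s1 s2 t1 t2 q) > 0"
      then show "conformal_frame M \<phi> \<omega> N (spinor_matrix s1 s2 t1 t2)"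
        unfolding det using pos by (intro surface_conformal_frame[OF surface]) blast
    qed
  qed
qed

end
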